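(* Let $H^m:\mathbb{R}^d\to\mathbb{R}^s$ and $H^v:\mathbb{R}^d\to\mathbb{R}^{s^2}$ be the quadratic and cubic observation functions defined in the context (with $H^v$ stretched into a vector), let $\Gamma_m\in\mathbb{R}^{s\times s}$ and $\Gamma_v\in\mathbb{R}^{s^2\times s^2}$ be symmetric invertible matrices, and let $\tilde\rho$ be a probability distribution on $\mathbb{R}^d$ with respect to which $\bar H^m=\tilde{\mathbb{E}}[H^m]\in\mathbb{R}^s$ and $\bar H^v=\tilde{\mathbb{E}}[H^v]\in\mathbb{R}^{s^2}$ are the (finite) mean values. Define for $Z\in\mathbb{R}^d$ $$K^m(Z)=\tfrac12 Z\,[H^m(Z)-\bar H^m]^T\Gamma_m^{-2},\qquad K^v(Z)=\tfrac13 Z\,[H^v(Z)-\bar H^v]^T\Gamma_v^{-2}.$$ Then the drift terms defined by $$a^m=\nabla\cdot\big(K^m\Gamma_m^2(K^m)^T\big)-K^m\Gamma_m^2\,\nabla\cdot\big((K^m)^T\big),\qquad a^v=\nabla\cdot\big(K^v\Gamma_v^2(K^v)^T\big)-K^v\Gamma_v^2\,\nabla\cdot\big((K^v)^T\big)$$ are given explicitly by $$a^m(Z)=\tfrac14 Z\,[H^m(Z)-\bar H^m]^T\Gamma_m^{-2}\,[3H^m(Z)-\bar H^m],$$ $$a^v(Z)=\tfrac19 Z\,[H^v(Z)-\bar H^v]^T\Gamma_v^{-2}\,[4H^v(Z)-\bar H^v].$$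
   Context: Fix $1\le s\le d$, an orthonormal basis $\{\hat v_k\}_{k=1}^d$ of $\mathbb{R}^d$, and a bilinear map $B:\mathbb{R}^d\times\mathbb{R}^d\to\mathbb{R}^d$ with $u\cdot B(u,u)=0$ for all $u$. Put $\gamma_{kpq}=\hat v_k\cdot B(\hat v_p,\hat v_q)$. For $z\in\mathbb{R}^d$ and $1\le k,l\le s$ the observation functions are $$H^m_k(z)=\sum_{p,q=1}^d\gamma_{kpq}z_pz_q,\qquad H^v_{kl}(z)=\sum_{p,q=1}^d\big(\gamma_{kpq}z_pz_qz_l+\gamma_{lpq}z_pz_qz_k\big).$$ The $s\times s$ array $H^v$ is regarded as a vector in $\mathbb{R}^{s^2}$ indexed by pairs $(k,l)$. Divergence of matrix-valued functions of $Z\in\mathbb{R}^d$ is taken row-wise over the second index: $(\nabla\cdot M)_i=\sum_{j=1}^d\partial_{Z_j}M_{ij}$; thus $(\nabla\cdot(K^T))_q=\sum_{j=1}^d\partial_{Z_j}K_{jq}$. The vectors $\bar H^m,\bar H^v$ and matrices $\Gamma_m,\Gamma_v$ are constants with respect to differentiation in $Z$. $\Gamma^{-2}$ means $(\Gamma^{-1})^2$. *)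

theory Defs
  imports "HOL-Probability.Probability"
begin

definition orthonormal_basis :: "('d \<Rightarrow> real^'d) \<Rightarrow> bool" where
  "orthonormal_basis v \<longleftrightarrow>
     (\<forall>i j. v i \<bullet> v j = (if i = j then 1 else 0)) \<and> span (range v) = UNIV"

definition structure_coeff ::
  "('d \<Rightarrow> real^'d) \<Rightarrow> (real^'d \<Rightarrow> real^'d \<Rightarrow> real^'d) \<Rightarrow> 'd \<Rightarrow> 'd \<Rightarrow> 'd \<Rightarrow> real" where
  "structure_coeff v B k p q = v k \<bullet> B (v p) (v q)"

text \<open>
  The observed indices \<open>1, ..., s\<close> among \<open>1, ..., d\<close> are given by an embedding
  \<open>\<iota> :: 's \<Rightarrow> 'd\<close> of finite index types. The coordinate \<open>z\<^sub>p\<close> is the component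
  \<open>z $ p\<close>, and derivatives are taken with respect to these components; \<open>v\<close> enters
  only through the structure coefficients.
\<close>

definition obs_mean ::
  "('d \<Rightarrow> real^'d) \<Rightarrow> (real^'d \<Rightarrow> real^'d \<Rightarrow> real^'d) \<Rightarrow> ('s \<Rightarrow> 'd) \<Rightarrow> real^'d \<Rightarrow> real^'s" where
  "obs_mean v B \<iota> z =
     (\<chi> k. \<Sum>p\<in>UNIV. \<Sum>q\<in>UNIV. structure_coeff v B (\<iota> k) p q * z $ p * z $ q)"

definition obs_cov ::
  "('d \<Rightarrow> real^'d) \<Rightarrow> (real^'d \<Rightarrow> real^'d \<Rightarrow> real^'d) \<Rightarrow> ('s::finite \<Rightarrow> 'd) \<Rightarrow> real^'d \<Rightarrow> real^('s \<times> 's)" where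
  "obs_cov v B \<iota> z =
     (\<chi> kl. case kl of (k, l) \<Rightarrow>
        \<Sum>p\<in>UNIV. \<Sum>q\<in>UNIV.
          structure_coeff v B (\<iota> k) p q * z $ p * z $ q * z $ \<iota> l
        + structure_coeff v B (\<iota> l) p q * z $ p * z $ q * z $ \<iota> k)"

definition outer_product :: "real^'m \<Rightarrow> real^'n \<Rightarrow> real^'n^'m" where
  "outer_product x y = (\<chi> i j. x $ i * y $ j)"

definition mat_sq :: "real^'n^'n \<Rightarrow> real^'n^'n" where
  "mat_sq A = A ** A"

definition partial_deriv :: "'d \<Rightarrow> (real^'d \<Rightarrow> real) \<Rightarrow> real^'d \<Rightarrow> real" where
  "partial_deriv j f Z = deriv (\<lambda>t. f (Z + t *\<^sub>R axis j 1)) 0"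

definition divergence :: "(real^'d \<Rightarrow> real^'d^'m) \<Rightarrow> real^'d \<Rightarrow> real^'m" where
  "divergence M Z = (\<chi> i. \<Sum>j\<in>UNIV. partial_deriv j (\<lambda>z. M z $ i $ j) Z)"

definition gain ::
  "real \<Rightarrow> (real^'d \<Rightarrow> real^'n) \<Rightarrow> real^'n \<Rightarrow> real^'n^'n \<Rightarrow> real^'d \<Rightarrow> real^'n^'d" where
  "gain c H Hbar \<Gamma> Z = c *\<^sub>R (outer_product Z (H Z - Hbar) ** mat_sq (matrix_inv \<Gamma>))"

definition drift :: "(real^'d \<Rightarrow> real^'n^'d) \<Rightarrow> real^'n^'n \<Rightarrow> real^'d \<Rightarrow> real^'d" where
  "drift K \<Gamma> Z =
     divergence (\<lambda>z. K z ** mat_sq \<Gamma> ** transpose (K z)) Z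
     - (K Z ** mat_sq \<Gamma>) *v divergence (\<lambda>z. transpose (K z)) Z"

end

(* Let P be the square of the inverse of Gamma and h = H - Hbar. The gain is the rank-one matrix
   c Z (P h)^T, so both divergences in the drift are, row by row, divergences of radial fields
   f(Z) Z, which equal d f + f'(Z) Z. By Euler's identity the radial derivative of an observation function that
   is homogeneous of degree n is n H. The dimension d cancels, leaving
   c^2 (h . P h + n h . P H) Z = c^2 Z h^T P ((n + 1) H - Hbar), with n = 2 or n = 3. *)
theory Submission
  imports Defs
begin

text \<open>Keeps the calculation rank one: a right factor acts on the second vector alone, so
  products with the gain need not be expanded into entries.\<close>

lemma outer_product_mult:
  "outer_product x y ** A = outer_product x (transpose A *v y)"
  by (simp add: outer_product_def matrix_matrix_mult_def matrix_vector_mult_def transpose_def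
      vec_eq_iff sum_distrib_left mult_ac)

lemma outer_product_mult_vec: "outer_product x y *v w = (y \<bullet> w) *\<^sub>R x"
  by (simp add: outer_product_def matrix_vector_mult_def vec_eq_iff inner_vec_def
      sum_distrib_left mult_ac)

lemma transpose_outer_product: "transpose (outer_product x y) = outer_product y x"
  by (simp add: outer_product_def transpose_def vec_eq_iff)

lemma outer_product_scaleR_right: "outer_product x (c *\<^sub>R y) = c *\<^sub>R outer_product x y"
  by (simp add: outer_product_def vec_eq_iff)

lemma matrix_inv_right:
  fixes A :: "'a::semiring_1^'n^'m"
  assumes "invertible A"
  shows "A ** matrix_inv A = mat 1"
  using someI_ex[OF assms[unfolded invertible_def]] by (simp add: matrix_inv_def)

lemma mat_sq_inv_mult:
  assumes "invertible \<Gamma>"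
  shows "mat_sq \<Gamma> ** mat_sq (matrix_inv \<Gamma>) = mat 1"
proof -
  have "mat_sq \<Gamma> ** mat_sq (matrix_inv \<Gamma>) = \<Gamma> ** (\<Gamma> ** matrix_inv \<Gamma>) ** matrix_inv \<Gamma>"
    by (simp add: mat_sq_def matrix_mul_assoc)
  then show ?thesis
    by (simp add: matrix_inv_right[OF assms])
qed

lemma transpose_mat_sq:
  "transpose \<Gamma> = \<Gamma> \<Longrightarrow> transpose (mat_sq \<Gamma>) = mat_sq \<Gamma>"
  by (simp add: mat_sq_def matrix_transpose_mul)

text \<open>Transposing the right-inverse identity makes the transposed inverse a left inverse of
  the symmetric \<open>\<Gamma>\<close>, and a left inverse equals a right inverse by
  associativity.\<close>

lemma transpose_matrix_inv:
  fixes \<Gamma> :: "real^'n^'n"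
  assumes "invertible \<Gamma>" "transpose \<Gamma> = \<Gamma>"
  shows "transpose (matrix_inv \<Gamma>) = matrix_inv \<Gamma>"
proof -
  have "transpose (matrix_inv \<Gamma>) ** \<Gamma> = mat 1"
    by (metis assms matrix_inv_right matrix_transpose_mul transpose_mat)
  then show ?thesis
    by (metis assms(1) matrix_inv_right matrix_mul_assoc matrix_mul_lid matrix_mul_rid)
qed

text \<open>Chain rule along the line through \<open>Z\<close> in direction \<open>axis j 1\<close>.
  It replaces \<open>deriv\<close>, which says nothing unless a derivative exists, by the Frechet
  derivative.\<close>

lemma partial_deriv_eq:
  assumes "(f has_derivative f') (at Z)"
  shows "partial_deriv j f Z = f' (axis j 1)"
proof -
  have "((\<lambda>t. f (Z + t *\<^sub>R axis j 1)) has_derivative (\<lambda>t. f' (t *\<^sub>R axis j 1))) (at 0)"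
    by (rule has_derivative_compose[where g = f]) (auto intro!: derivative_eq_intros simp: assms)
  then have "((\<lambda>t. f (Z + t *\<^sub>R axis j 1)) has_real_derivative f' (axis j 1)) (at 0)"
    using has_derivative_linear[OF assms]
    by (simp add: has_field_derivative_def linear_cmul mult_commute_abs)
  then show ?thesis
    unfolding partial_deriv_def by (rule DERIV_imp_deriv)
qed

text \<open>By the product rule each of the d coordinates contributes \<open>f Z\<close> once, and
  the remaining terms sum to \<open>f' Z\<close> by linearity. Only row \<open>i\<close> has to be
  radial, so \<open>f\<close> may change from row to row.\<close>

lemma divergence_radial_eq:
  fixes F :: "real^'d \<Rightarrow> real^'d^'m"
  assumes F: "\<And>z j. F z $ i $ j = f z * z $ j"
    and f: "(f has_derivative f') (at Z)"
  shows "divergence F Z $ i = real CARD('d) * f Z + f' Z"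
proof -
  have "partial_deriv j (\<lambda>z. F z $ i $ j) Z = f Z + Z $ j * f' (axis j 1)" for j
  proof -
    have "((\<lambda>z. f z * z $ j) has_derivative (\<lambda>w. f Z * w $ j + f' w * Z $ j)) (at Z)"
      by (intro has_derivative_mult f bounded_linear.has_derivative[OF bounded_linear_vec_nth]
          has_derivative_ident)
    from partial_deriv_eq[OF this] show ?thesis
      by (simp add: F)
  qed
  moreover have "f' Z = (\<Sum>j\<in>UNIV. Z $ j * f' (axis j 1))"
  proof -
    have lin: "linear f'"
      using f by (rule has_derivative_linear)
    have "f' Z = f' (\<Sum>j\<in>UNIV. Z $ j *\<^sub>R axis j 1)"
      by (simp add: basis_expansion flip: scalar_mult_eq_scaleR)
    also have "\<dots> = (\<Sum>j\<in>UNIV. Z $ j * f' (axis j 1))"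
      by (simp add: linear_sum[OF lin] linear_cmul[OF lin])
    finally show ?thesis .
  qed
  ultimately show ?thesis
    by (simp add: divergence_def sum.distrib)
qed

text \<open>Differentiate \<open>H (t *\<^sub>R Z)\<close> at t = 1 twice, by the chain rule and by
  homogeneity, and compare.\<close>

lemma euler_homogeneous:
  fixes H :: "'a::real_normed_vector \<Rightarrow> 'b::real_normed_vector"
  assumes H: "(H has_derivative D) (at Z)"
    and hom: "\<And>t. H (t *\<^sub>R Z) = t ^ n *\<^sub>R H Z"
  shows "D Z = real n *\<^sub>R H Z"
proof -
  have "((\<lambda>t. H (t *\<^sub>R Z)) has_derivative (\<lambda>t. D (t *\<^sub>R Z))) (at (1::real))"
    by (rule has_derivative_compose[where g = H]) (auto intro!: derivative_eq_intros simp: H)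
  moreover have "((\<lambda>t. t ^ n *\<^sub>R H Z) has_derivative (\<lambda>t. (real n * t) *\<^sub>R H Z)) (at (1::real))"
    by (auto intro!: derivative_eq_intros)
  ultimately have "(\<lambda>t. D (t *\<^sub>R Z)) = (\<lambda>t. (real n * t) *\<^sub>R H Z)"
    unfolding hom by (rule has_derivative_unique)
  from fun_cong[OF this, of 1] show ?thesis
    by simp
qed

lemma drift_gain_homogeneous:
  fixes H :: "real^'d \<Rightarrow> real^'n" and \<Gamma> :: "real^'n^'n"
  assumes sym: "transpose \<Gamma> = \<Gamma>" and inv: "invertible \<Gamma>"
    and diff: "H differentiable (at Z)"
    and hom: "\<And>t. H (t *\<^sub>R Z) = t ^ n *\<^sub>R H Z"
  shows "drift (gain c H Hbar \<Gamma>) \<Gamma> Z =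
    c\<^sup>2 *\<^sub>R ((outer_product Z (H Z - Hbar) ** mat_sq (matrix_inv \<Gamma>)) *v (real (Suc n) *\<^sub>R H Z - Hbar))"
proof -
  define P where "P = mat_sq (matrix_inv \<Gamma>)"
  define h where "h = (\<lambda>z. H z - Hbar)"
  have P_sym: "transpose P = P"
    unfolding P_def by (intro transpose_mat_sq transpose_matrix_inv inv sym)
  have GP: "mat_sq \<Gamma> *v (P *v x) = x" for x
    by (simp add: P_def matrix_vector_mul_assoc mat_sq_inv_mult[OF inv])
  have K: "gain c H Hbar \<Gamma> z = outer_product z (c *\<^sub>R (P *v h z))" for z
    by (simp add: gain_def h_def outer_product_mult P_sym outer_product_scaleR_right flip: P_def)
  \<comment> \<open>The factor \<open>mat_sq \<Gamma>\<close> cancels \<open>P\<close>, so the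
    weight disappears from the second vector.\<close>
  have KG: "gain c H Hbar \<Gamma> z ** mat_sq \<Gamma> = outer_product z (c *\<^sub>R h z)" for z
    by (simp add: K outer_product_mult transpose_mat_sq[OF sym] GP matrix_vector_mult_scaleR)
  obtain D where H: "(H has_derivative D) (at Z)"
    using diff by (auto simp: differentiable_def)
  have h: "(h has_derivative D) (at Z)"
    unfolding h_def using H by (auto intro!: derivative_eq_intros)
  have DZ: "D Z = real n *\<^sub>R H Z"
    by (rule euler_homogeneous[OF H hom])
  have Ph: "((\<lambda>z. P *v h z) has_derivative (\<lambda>w. P *v D w)) (at Z)"
    by (rule bounded_linear.has_derivative[OF matrix_vector_mul_bounded_linear h])
  \<comment> \<open>Self-adjointness of \<open>P\<close> lets the two terms from differentiating the
    quadratic form in \<open>h\<close> merge.\<close>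
  have P_inner: "x \<bullet> (P *v y) = y \<bullet> (P *v x)" for x y
    by (metis P_sym dot_lmul_matrix inner_commute transpose_matrix_vector)

  have div_KT: "divergence (\<lambda>z. transpose (gain c H Hbar \<Gamma> z)) Z =
      c *\<^sub>R (P *v (real CARD('d) *\<^sub>R h Z + real n *\<^sub>R H Z))"
  proof (unfold vec_eq_iff, rule allI)
    fix q
    \<comment> \<open>Row q of the transposed gain is radial with this factor f; at \<open>Z\<close>
      its derivative is evaluated by \<open>DZ\<close>.\<close>
    have "((\<lambda>z. c * (P *v h z) $ q) has_derivative (\<lambda>w. c * (P *v D w) $ q)) (at Z)"
      by (intro has_derivative_mult_right
          bounded_linear.has_derivative[OF bounded_linear_vec_nth Ph])
    from divergence_radial_eq[OF _ this, of "\<lambda>z. transpose (gain c H Hbar \<Gamma> z)" q]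
    show "divergence (\<lambda>z. transpose (gain c H Hbar \<Gamma> z)) Z $ q =
      (c *\<^sub>R (P *v (real CARD('d) *\<^sub>R h Z + real n *\<^sub>R H Z))) $ q"
      by (simp add: K transpose_outer_product, simp add: outer_product_def DZ
          matrix_vector_mult_scaleR matrix_vector_right_distrib algebra_simps)
  qed

  have KGKT: "gain c H Hbar \<Gamma> z ** mat_sq \<Gamma> ** transpose (gain c H Hbar \<Gamma> z) =
      outer_product z ((c\<^sup>2 * (h z \<bullet> (P *v h z))) *\<^sub>R z)" for z
    by (simp add: KG outer_product_mult)
      (simp add: K outer_product_mult_vec inner_commute power2_eq_square mult_ac)
  \<comment> \<open>Row i is radial with f = c^2 (h . P h) z_i. The factor z_i has degree one and
    raises d to d + 1; the two occurrences of \<open>h\<close> give 2 n.\<close>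
  have div_KGKT: "divergence (\<lambda>z. gain c H Hbar \<Gamma> z ** mat_sq \<Gamma> ** transpose (gain c H Hbar \<Gamma> z)) Z =
      (c\<^sup>2 * (real (Suc CARD('d)) * (h Z \<bullet> (P *v h Z)) + 2 * real n * (h Z \<bullet> (P *v H Z)))) *\<^sub>R Z"
  proof (unfold vec_eq_iff, rule allI)
    fix i
    have "((\<lambda>z. c\<^sup>2 * (h z \<bullet> (P *v h z)) * z $ i) has_derivative
        (\<lambda>w. c\<^sup>2 * (h Z \<bullet> (P *v h Z)) * w $ i + c\<^sup>2 * (h Z \<bullet> (P *v D w) + D w \<bullet> (P *v h Z)) * Z $ i))
        (at Z)"
      by (intro has_derivative_mult has_derivative_mult_right has_derivative_inner h Ph
          bounded_linear.has_derivative[OF bounded_linear_vec_nth] has_derivative_ident)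
    from divergence_radial_eq[OF _ this,
        of "\<lambda>z. gain c H Hbar \<Gamma> z ** mat_sq \<Gamma> ** transpose (gain c H Hbar \<Gamma> z)" i]
    show "divergence (\<lambda>z. gain c H Hbar \<Gamma> z ** mat_sq \<Gamma> ** transpose (gain c H Hbar \<Gamma> z)) Z $ i =
      ((c\<^sup>2 * (real (Suc CARD('d)) * (h Z \<bullet> (P *v h Z)) + 2 * real n * (h Z \<bullet> (P *v H Z)))) *\<^sub>R Z) $ i"
      unfolding KGKT
      by (simp add: outer_product_def DZ matrix_vector_mult_scaleR P_inner[of "H Z"] algebra_simps)
  qed

  \<comment> \<open>The subtracted term is c^2 (d h . P h + n h . P H) Z, so d + 1 drops to 1 and 2
    n drops to n.\<close>
  have "drift (gain c H Hbar \<Gamma>) \<Gamma> Z =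
      (c\<^sup>2 * (h Z \<bullet> (P *v h Z) + real n * (h Z \<bullet> (P *v H Z)))) *\<^sub>R Z"
    unfolding drift_def div_KGKT div_KT unfolding KG outer_product_mult_vec
    by (simp add: vec_eq_iff matrix_vector_mult_scaleR matrix_vector_right_distrib inner_add_right
        power2_eq_square algebra_simps)
  \<comment> \<open>Since h + n H = (n + 1) H - Hbar, both terms combine; \<open>P\<close> moves to
    the left factor to match the rank-one form of the claim.\<close>
  also have "h Z \<bullet> (P *v h Z) + real n * (h Z \<bullet> (P *v H Z)) =
      (P *v h Z) \<bullet> (real (Suc n) *\<^sub>R H Z - Hbar)"
    by (subst inner_commute, subst P_inner[symmetric])
      (simp add: h_def matrix_vector_mult_scaleR matrix_vector_mult_diff_distrib
        inner_diff_right algebra_simps)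
  finally show ?thesis
    by (simp add: outer_product_mult outer_product_mult_vec P_sym h_def flip: P_def)
qed

text \<open>Reduces differentiability of the observation functions to their coordinates, which are
  polynomials. The coordinate derivatives, stacked into a vector, form the derivative of
  \<open>f\<close>.\<close>

lemma differentiable_vec_nthI:
  fixes f :: "'a::real_normed_vector \<Rightarrow> real^'n"
  assumes "\<And>i. (\<lambda>z. f z $ i) differentiable (at x)"
  shows "f differentiable (at x)"
proof -
  from assms obtain D where "\<And>i. ((\<lambda>z. f z $ i) has_derivative D i) (at x)"
    unfolding differentiable_def by metis
  then have "(f has_derivative (\<lambda>w. \<chi> i. D i w)) (at x)"
    by (subst has_derivative_componentwise_within) (auto simp: Basis_vec_def inner_axis)
  then show ?thesis
    by (auto simp: differentiable_def)
qed

lemma differentiable_vec_nth [derivative_intros]: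
  "(\<lambda>z. z $ i) differentiable (at (x :: real^'n))"
  using bounded_linear_imp_differentiable[OF bounded_linear_vec_nth] .

lemma obs_mean_differentiable: "obs_mean v B \<iota> differentiable (at Z)"
  by (rule differentiable_vec_nthI) (simp add: obs_mean_def derivative_intros)

lemma obs_mean_homogeneous: "obs_mean v B \<iota> (t *\<^sub>R z) = t ^ 2 *\<^sub>R obs_mean v B \<iota> z"
  by (simp add: obs_mean_def vec_eq_iff sum_distrib_left power2_eq_square mult_ac)

lemma obs_cov_differentiable: "obs_cov v B \<iota> differentiable (at Z)"
  by (rule differentiable_vec_nthI) (auto simp: obs_cov_def intro!: derivative_intros split: prod.split)

lemma obs_cov_homogeneous: "obs_cov v B \<iota> (t *\<^sub>R z) = t ^ 3 *\<^sub>R obs_cov v B \<iota> z"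
  by (simp add: obs_cov_def vec_eq_iff sum_distrib_left power3_eq_cube algebra_simps
      split: prod.split)

theorem proposition3:
  fixes v :: "'d::finite \<Rightarrow> real^'d"
    and B :: "real^'d \<Rightarrow> real^'d \<Rightarrow> real^'d"
    and \<iota> :: "'s::finite \<Rightarrow> 'd"
    and \<Gamma>\<^sub>m :: "real^'s^'s"
    and \<Gamma>\<^sub>v :: "real^('s \<times> 's)^('s \<times> 's)"
    and \<rho> :: "(real^'d) measure"
    and Hm_bar :: "real^'s"
    and Hv_bar :: "real^('s \<times> 's)"
    and Hm :: "real^'d \<Rightarrow> real^'s"
    and Hv :: "real^'d \<Rightarrow> real^('s \<times> 's)"
    and Km :: "real^'d \<Rightarrow> real^'s^'d"
    and Kv :: "real^'d \<Rightarrow> real^('s \<times> 's)^'d"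
    and Z :: "real^'d"
  assumes "inj \<iota>"
    and "orthonormal_basis v"
    and "bilinear B"
    and "\<And>u. u \<bullet> B u u = 0"
    and "Hm = obs_mean v B \<iota>"
    and "Hv = obs_cov v B \<iota>"
    and "transpose \<Gamma>\<^sub>m = \<Gamma>\<^sub>m" and "invertible \<Gamma>\<^sub>m"
    and "transpose \<Gamma>\<^sub>v = \<Gamma>\<^sub>v" and "invertible \<Gamma>\<^sub>v"
    and "prob_space \<rho>" and "sets \<rho> = sets borel"
    and "integrable \<rho> Hm" and "Hm_bar = (\<integral>z. Hm z \<partial>\<rho>)"
    and "integrable \<rho> Hv" and "Hv_bar = (\<integral>z. Hv z \<partial>\<rho>)"
    and "Km = gain (1/2) Hm Hm_bar \<Gamma>\<^sub>m"
    and "Kv = gain (1/3) Hv Hv_bar \<Gamma>\<^sub>v"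
  shows "drift Km \<Gamma>\<^sub>m Z =
           (1/4) *\<^sub>R ((outer_product Z (Hm Z - Hm_bar) ** mat_sq (matrix_inv \<Gamma>\<^sub>m))
                    *v (3 *\<^sub>R Hm Z - Hm_bar))
       \<and> drift Kv \<Gamma>\<^sub>v Z =
           (1/9) *\<^sub>R ((outer_product Z (Hv Z - Hv_bar) ** mat_sq (matrix_inv \<Gamma>\<^sub>v))
                    *v (4 *\<^sub>R Hv Z - Hv_bar))"
  \<comment> \<open>The homogeneity lemmas fix n = 2 and n = 3, whence the coefficients 3 and 4;
    squaring c = 1/2 and c = 1/3 gives 1/4 and 1/9.\<close>
  using drift_gain_homogeneous[OF assms(7,8) obs_mean_differentiable obs_mean_homogeneous,
      of "1/2" v B \<iota> Hm_bar Z]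
    drift_gain_homogeneous[OF assms(9,10) obs_cov_differentiable obs_cov_homogeneous,
      of "1/3" v B \<iota> Hv_bar Z]
  by (simp add: assms(5,6,17,18) power2_eq_square)

end
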